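(* There is a well-founded quasicontinuous dcpo $P$ which is neither algebraic nor quasialgebraic and has the following properties. (1) The maximal elements of $P$ form an antichain of cardinality $2^{\aleph_0}$. (2) Every chain in $P$ is order-isomorphic to a suborder of $\omega+1$. (3) $P$ contains no sub-dcpo isomorphic to $[0,1]$, and $[0,1]$ is not a Scott-continuous retract of $P$.
   Context: The interval $[0,1]$ carries its usual order. A dcpo is a poset in which every nonempty directed subset has a supremum. A poset is well-founded if it has no infinite strictly descending chain. For a dcpo $P$ and $A\subseteq P$, $\uparrow A=\{p\in P:\exists a\in A,\ a\le p\}$ and $\uparrow x=\uparrow\{x\}$. For $A,B\subseteq P$, $A\ll B$ means: for every (nonempty) directed $D\subseteq P$, $\bigvee D\in\uparrow B$ implies $D\cap\uparrow A\neq\varnothing$; write $A\ll x$ for $A\ll\{x\}$ and $x\ll y$ for $\{x\}\ll\{y\}$. A family of sets is filtered under inclusion if it is nonempty and any two members contain a common member. $P$ is quasicontinuous if for every $x\in P$ the family $\{\uparrow F: F\subseteq P \text{ finite}, F\ll x\}$ is filtered under inclusion and has intersection $\uparrow x$. $P$ is quasialgebraic if for every $x\in P$ the family $\{\uparrow F: F\subseteq P\text{ finite}, x\in\uparrow F, F\ll F\}$ is filtered under inclusion and has intersection $\uparrow x$. An element $c$ is compact if $c\ll c$; $P$ is algebraic if for every $x\in P$ the compact elements below $x$ form a directed set with supremum $x$. A sub-dcpo of $P$ is a subset closed under suprema (taken in $P$) of its nonempty directed subsets, with the inherited order. A map between dcpos is Scott-continuous if it is monotone and preserves suprema of directed sets.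 $[0,1]$ is a Scott-continuous retract of $P$ if there are Scott-continuous maps $r:P\to[0,1]$ and $e:[0,1]\to P$ with $r\circ e=\mathrm{id}_{[0,1]}$. *)

theory Defs
  imports Complex_Main "HOL-Library.Equipollence" "HOL-Library.Extended_Nat"
begin

text \<open>
  A poset is a carrier set \<open>P\<close> together with a relation \<open>r\<close> satisfying
  \<^term>\<open>partial_order_on P r\<close>, where \<open>(x, y) \<in> r\<close> means \<open>x \<le> y\<close>; in particular
  \<open>r \<subseteq> P \<times> P\<close>. Directed sets are nonempty by definition.
\<close>

definition directed_in :: "'a set \<Rightarrow> 'a rel \<Rightarrow> 'a set \<Rightarrow> bool" where
  "directed_in P r D \<longleftrightarrow>
     D \<subseteq> P \<and> D \<noteq> {} \<and> (\<forall>x\<in>D. \<forall>y\<in>D. \<exists>z\<in>D. (x, z) \<in> r \<and> (y, z) \<in> r)"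

definition is_sup_in :: "'a set \<Rightarrow> 'a rel \<Rightarrow> 'a set \<Rightarrow> 'a \<Rightarrow> bool" where
  "is_sup_in P r D s \<longleftrightarrow>
     s \<in> P \<and> (\<forall>d\<in>D. (d, s) \<in> r) \<and> (\<forall>u\<in>P. (\<forall>d\<in>D. (d, u) \<in> r) \<longrightarrow> (s, u) \<in> r)"

definition dcpo_on :: "'a set \<Rightarrow> 'a rel \<Rightarrow> bool" where
  "dcpo_on P r \<longleftrightarrow>
     partial_order_on P r \<and> (\<forall>D. directed_in P r D \<longrightarrow> (\<exists>s. is_sup_in P r D s))"

definition well_founded_on :: "'a set \<Rightarrow> 'a rel \<Rightarrow> bool" where
  "well_founded_on P r \<longleftrightarrow>
     \<not> (\<exists>f :: nat \<Rightarrow> 'a. \<forall>i. f i \<in> P \<and> (f (Suc i), f i) \<in> r \<and> f (Suc i) \<noteq> f i)"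

definition upset :: "'a set \<Rightarrow> 'a rel \<Rightarrow> 'a set \<Rightarrow> 'a set" where
  "upset P r A = {p \<in> P. \<exists>a\<in>A. (a, p) \<in> r}"

definition way_below :: "'a set \<Rightarrow> 'a rel \<Rightarrow> 'a set \<Rightarrow> 'a set \<Rightarrow> bool" where
  "way_below P r A B \<longleftrightarrow>
     (\<forall>D s. directed_in P r D \<longrightarrow> is_sup_in P r D s \<longrightarrow> s \<in> upset P r B
        \<longrightarrow> D \<inter> upset P r A \<noteq> {})"

definition filtered_family :: "'a set set \<Rightarrow> bool" where
  "filtered_family \<F> \<longleftrightarrow> \<F> \<noteq> {} \<and> (\<forall>U\<in>\<F>. \<forall>V\<in>\<F>. \<exists>W\<in>\<F>. W \<subseteq> U \<inter> V)"

definition quasicontinuous_on :: "'a set \<Rightarrow> 'a rel \<Rightarrow> bool" where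
  "quasicontinuous_on P r \<longleftrightarrow>
     (\<forall>x\<in>P. let \<F> = {upset P r F |F. F \<subseteq> P \<and> finite F \<and> way_below P r F {x}}
       in filtered_family \<F> \<and> \<Inter>\<F> = upset P r {x})"

definition quasialgebraic_on :: "'a set \<Rightarrow> 'a rel \<Rightarrow> bool" where
  "quasialgebraic_on P r \<longleftrightarrow>
     (\<forall>x\<in>P. let \<F> = {upset P r F |F. F \<subseteq> P \<and> finite F \<and> x \<in> upset P r F \<and> way_below P r F F}
       in filtered_family \<F> \<and> \<Inter>\<F> = upset P r {x})"

definition compact_in :: "'a set \<Rightarrow> 'a rel \<Rightarrow> 'a \<Rightarrow> bool" where
  "compact_in P r c \<longleftrightarrow> c \<in> P \<and> way_below P r {c} {c}"

definition algebraic_on :: "'a set \<Rightarrow> 'a rel \<Rightarrow> bool" where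
  "algebraic_on P r \<longleftrightarrow>
     (\<forall>x\<in>P. let K = {c. compact_in P r c \<and> (c, x) \<in> r}
       in directed_in P r K \<and> is_sup_in P r K x)"

definition maximal_elements :: "'a set \<Rightarrow> 'a rel \<Rightarrow> 'a set" where
  "maximal_elements P r = {m \<in> P. \<forall>x\<in>P. (m, x) \<in> r \<longrightarrow> x = m}"

definition antichain_in :: "'a set \<Rightarrow> 'a rel \<Rightarrow> 'a set \<Rightarrow> bool" where
  "antichain_in P r A \<longleftrightarrow> A \<subseteq> P \<and> (\<forall>x\<in>A. \<forall>y\<in>A. (x, y) \<in> r \<longrightarrow> x = y)"

definition chain_in :: "'a set \<Rightarrow> 'a rel \<Rightarrow> 'a set \<Rightarrow> bool" where
  "chain_in P r C \<longleftrightarrow> C \<subseteq> P \<and> (\<forall>x\<in>C. \<forall>y\<in>C. (x, y) \<in> r \<or> (y, x) \<in> r)"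

text \<open>
  In \<open>order_isomorphic A r B s\<close> only the restrictions of \<open>r\<close> to \<open>A\<close> and of \<open>s\<close> to \<open>B\<close>
  matter, so subsets are compared with their inherited orders.
\<close>

definition order_isomorphic :: "'a set \<Rightarrow> 'a rel \<Rightarrow> 'b set \<Rightarrow> 'b rel \<Rightarrow> bool" where
  "order_isomorphic A r B s \<longleftrightarrow>
     (\<exists>f. bij_betw f A B \<and> (\<forall>x\<in>A. \<forall>y\<in>A. (x, y) \<in> r \<longleftrightarrow> (f x, f y) \<in> s))"

text \<open>The ordinal \<open>\<omega> + 1\<close> is represented by the linear order \<^typ>\<open>enat\<close>, with \<open>\<infinity>\<close> as top.\<close>

definition omega_plus_one_le :: "enat rel" where
  "omega_plus_one_le = {(m, n). m \<le> n}"

definition unit_interval :: "real set" where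
  "unit_interval = {0..1}"

definition unit_interval_le :: "real rel" where
  "unit_interval_le = {(x, y). x \<in> unit_interval \<and> y \<in> unit_interval \<and> x \<le> y}"

definition sub_dcpo :: "'a set \<Rightarrow> 'a rel \<Rightarrow> 'a set \<Rightarrow> bool" where
  "sub_dcpo P r Q \<longleftrightarrow>
     Q \<subseteq> P \<and> (\<forall>D s. D \<subseteq> Q \<longrightarrow> directed_in P r D \<longrightarrow> is_sup_in P r D s \<longrightarrow> s \<in> Q)"

definition scott_continuous ::
  "'a set \<Rightarrow> 'a rel \<Rightarrow> 'b set \<Rightarrow> 'b rel \<Rightarrow> ('a \<Rightarrow> 'b) \<Rightarrow> bool" where
  "scott_continuous P r Q s f \<longleftrightarrow>
     f ` P \<subseteq> Q \<and>
     (\<forall>x\<in>P. \<forall>y\<in>P. (x, y) \<in> r \<longrightarrow> (f x, f y) \<in> s) \<and>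
     (\<forall>D u. directed_in P r D \<longrightarrow> is_sup_in P r D u \<longrightarrow> is_sup_in Q s (f ` D) (f u))"

definition scott_retract_of :: "'b set \<Rightarrow> 'b rel \<Rightarrow> 'a set \<Rightarrow> 'a rel \<Rightarrow> bool" where
  "scott_retract_of Q s P r \<longleftrightarrow>
     (\<exists>\<rho> e. scott_continuous P r Q s \<rho> \<and> scott_continuous Q s P r e \<and> (\<forall>x\<in>Q. \<rho> (e x) = x))"

end

theory Submission
  imports Defs "HOL-Analysis.Abstract_Topology_2"
begin

text \<open>
  The dcpo consists of the closed dyadic intervals of the real line of length at most \<open>1\<close>
  together with the singletons, ordered by reverse inclusion. An interval of length \<open>2\<^sup>-\<^sup>n\<close>
  has finite rank \<open>n\<close>, which gives well-foundedness and the bound on chains; a directed set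
  without a greatest element has arbitrarily short members and supremum a singleton.

  For \<open>A = {a..b}\<close>, a dyadic interval of level \<open>n\<close> that meets \<open>A\<close> lies inside \<open>A\<close>, or
  is the level-\<open>n\<close> interval reaching \<open>a\<close> from the left, or the one reaching \<open>b\<close> from the
  right. Hence \<open>A\<close> and these two intervals form a finite set way below \<open>A\<close>, and these sets
  shrink to \<open>A\<close>. On the other hand, a dyadic interval is never compact: the points at its ends
  are also approximated from outside. The same argument at the largest right endpoint \<open>b\<close> of a
  finite nonempty \<open>F\<close> refutes \<open>F \<lless> F\<close>, since the intervals shrinking to \<open>b\<close>
  from the right all stick out of \<open>\<Union>F\<close>. So there are no compact elements and no
  nonempty finite sets way below themselves.
\<close>

section \<open>Dyadic intervals, points, and inclusions between them\<close>

definition dyadic_ivl :: "nat \<Rightarrow> int \<Rightarrow> real set" where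
  "dyadic_ivl n k = {of_int k / 2^n .. (of_int k + 1) / 2^n}"

definition dyadic_dcpo :: "real set set" where
  "dyadic_dcpo = {dyadic_ivl n k |n k. True} \<union> range (\<lambda>x. {x})"

definition dyadic_le :: "real set rel" where
  "dyadic_le = {(A, B). A \<in> dyadic_dcpo \<and> B \<in> dyadic_dcpo \<and> B \<subseteq> A}"

lemma dyadic_ivl_in_dyadic_dcpo [simp]: "dyadic_ivl n k \<in> dyadic_dcpo"
  and singleton_in_dyadic_dcpo [simp]: "{x} \<in> dyadic_dcpo"
  by (auto simp: dyadic_dcpo_def)

lemma dyadic_le_iff: "(A, B) \<in> dyadic_le \<longleftrightarrow> A \<in> dyadic_dcpo \<and> B \<in> dyadic_dcpo \<and> B \<subseteq> A"
  by (simp add: dyadic_le_def)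

lemma dyadic_dcpo_cases:
  assumes "A \<in> dyadic_dcpo"
  obtains n k where "A = dyadic_ivl n k" | x where "A = {x}"
  using assms by (auto simp: dyadic_dcpo_def)

lemma mem_dyadic_ivl_iff: "x \<in> dyadic_ivl n k \<longleftrightarrow> of_int k \<le> x * 2^n \<and> x * 2^n \<le> of_int k + 1"
  by (simp add: dyadic_ivl_def field_simps)

text \<open>A singleton is the degenerate case \<open>a = b\<close>, so that later arguments can
  treat both kinds of elements uniformly through their endpoints.\<close>

lemma dyadic_dcpo_interval:
  assumes "A \<in> dyadic_dcpo"
  obtains a b where "a \<le> b" "A = {a..b}"
  using assms
proof (cases rule: dyadic_dcpo_cases)
  case (1 n k)
  have "real_of_int k / 2^n \<le> (of_int k + 1) / 2^n"
    by (simp add: divide_right_mono)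
  then show ?thesis using 1 that unfolding dyadic_ivl_def by blast
next
  case (2 x)
  then show ?thesis using that[of x x] by simp
qed

lemma dyadic_dcpo_nonempty: "A \<in> dyadic_dcpo \<Longrightarrow> A \<noteq> {}"
  by (erule dyadic_dcpo_interval) auto

lemma dyadic_dcpo_subset_singleton: "A \<in> dyadic_dcpo \<Longrightarrow> A \<subseteq> {x} \<Longrightarrow> A = {x}"
  by (drule dyadic_dcpo_nonempty) blast

lemma dyadic_ivl_dist:
  assumes "x \<in> dyadic_ivl n k" "y \<in> dyadic_ivl n k"
  shows "y \<le> x + 1 / 2^n"
  using assms by (simp add: mem_dyadic_ivl_iff field_simps)

lemma le_if_le_add_inverse_power:
  fixes x y :: real
  assumes "\<And>n. x \<le> y + 1 / 2^n"
  shows "x \<le> y"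
proof (rule ccontr)
  assume "\<not> x \<le> y"
  then obtain n where "(1/2)^n < x - y"
    using real_arch_pow_inv[of "x - y" "1/2"] by auto
  then show False using assms[of n] by (simp add: power_one_over)
qed

text \<open>An included interval is no longer than the one around it, and at equal length the
  endpoints agree. The first conclusion makes the level an invariant of the set.\<close>

lemma dyadic_ivl_subsetD:
  assumes "dyadic_ivl m j \<subseteq> dyadic_ivl n k"
  shows "n \<le> m" and "m = n \<Longrightarrow> j = k"
proof -
  \<comment> \<open>Inclusion of closed intervals gives the endpoint inequalities only when the
    inner interval is nonempty.\<close>
  have e: "of_int j / 2^m \<le> (of_int j + 1) / (2::real)^m"
    by (simp add: divide_right_mono)
  have s: "of_int k / 2^n \<le> of_int j / (2::real)^m" "(of_int j + 1) / (2::real)^m \<le> (of_int k + 1) / 2^n"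
    using assms e by (auto simp: dyadic_ivl_def)
  then have "1 / (2::real)^m \<le> 1 / 2^n"
    by (simp add: add_divide_distrib)
  then have "(2::real)^n \<le> 2^m"
    by (simp add: field_simps)
  then show "n \<le> m" by simp
  show "j = k" if "m = n"
    using s that by (simp add: field_simps)
qed

text \<open>The hypotheses say that \<open>k\<close> is the index of one of the two halves,
  \<open>2 * l\<close> or \<open>2 * l + 1\<close>. They are put as inequalities because estimates
  of floors and ceilings yield them in this form.\<close>

lemma dyadic_ivl_Suc_subset:
  assumes "2 * l \<le> k" "k \<le> 2 * l + 1"
  shows "dyadic_ivl (Suc n) k \<subseteq> dyadic_ivl n l"
proof
  fix x assume "x \<in> dyadic_ivl (Suc n) k"
  then have "real_of_int k \<le> 2 * (x * 2^n)" "2 * (x * 2^n) \<le> of_int k + 1"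
    by (simp_all add: mem_dyadic_ivl_iff mult_ac)
  moreover have "2 * real_of_int l \<le> of_int k" "real_of_int k \<le> 2 * of_int l + 1"
    using assms by linarith+
  ultimately show "x \<in> dyadic_ivl n l"
    unfolding mem_dyadic_ivl_iff by linarith
qed

lemma dyadic_ivl_coarsen:
  assumes "n \<le> m"
  obtains l where "dyadic_ivl m k \<subseteq> dyadic_ivl n l"
proof -
  have "\<exists>l. dyadic_ivl m k \<subseteq> dyadic_ivl n l"
    using assms
  proof (induction m arbitrary: k rule: dec_induct)
    case base
    then show ?case by blast
  next
    case (step m)
    have "dyadic_ivl (Suc m) k \<subseteq> dyadic_ivl m (k div 2)"
      by (rule dyadic_ivl_Suc_subset) auto
    with step.IH show ?case by blast
  qed
  then show ?thesis using that by blast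
qed

section \<open>The rank of an element\<close>

definition rk :: "real set \<Rightarrow> enat" where
  "rk A = (if \<exists>x. A = {x} then \<infinity> else enat (SOME n. \<exists>k. A = dyadic_ivl n k))"

lemma rk_singleton [simp]: "rk {x} = \<infinity>"
  by (simp add: rk_def)

lemma dyadic_ivl_not_singleton: "dyadic_ivl n k \<noteq> {x}"
proof
  assume "dyadic_ivl n k = {x}"
  moreover have "of_int k / 2^n \<in> dyadic_ivl n k" "(of_int k + 1) / 2^n \<in> dyadic_ivl n k"
    by (simp_all add: mem_dyadic_ivl_iff)
  ultimately have "real_of_int k / 2^n = (of_int k + 1) / 2^n" by auto
  then show False by simp
qed

lemma rk_dyadic_ivl [simp]: "rk (dyadic_ivl n k) = enat n"
proof -
  \<comment> \<open>Comparing levels in both directions shows that only one level is possible, so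
    the choice in \<open>rk\<close> is unambiguous.\<close>
  have "(SOME m. \<exists>j. dyadic_ivl n k = dyadic_ivl m j) = n"
    by (rule some_equality) (auto intro: antisym dyadic_ivl_subsetD(1)[OF equalityD1]
      dyadic_ivl_subsetD(1)[OF equalityD2])
  then show ?thesis by (simp add: rk_def dyadic_ivl_not_singleton)
qed

lemma rk_mono:
  assumes "A \<in> dyadic_dcpo" "B \<in> dyadic_dcpo" "B \<subseteq> A"
  shows "rk A \<le> rk B"
  using assms(2)
proof (cases rule: dyadic_dcpo_cases)
  case B: (1 m j)
  from assms(1) show ?thesis
  proof (cases rule: dyadic_dcpo_cases)
    case (1 n k)
    then show ?thesis using B assms(3) dyadic_ivl_subsetD(1) by simp
  next
    case (2 x)
    then show ?thesis using B assms dyadic_dcpo_subset_singleton dyadic_ivl_not_singleton by blast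
  qed
qed auto

text \<open>Nested intervals of the same level have the same index, and nested singletons coincide.
  Together with \<open>rk_mono\<close>, this makes the rank strictly increasing along the
  order.\<close>

lemma rk_inj:
  assumes "A \<in> dyadic_dcpo" "B \<in> dyadic_dcpo" "B \<subseteq> A" "rk A = rk B"
  shows "A = B"
  using assms(2)
proof (cases rule: dyadic_dcpo_cases)
  case B: (1 m j)
  from assms(1) show ?thesis
  proof (cases rule: dyadic_dcpo_cases)
    case (1 n k)
    then have "m = n" using B assms(4) by simp
    moreover have "j = k"
      by (rule dyadic_ivl_subsetD(2)[OF _ \<open>m = n\<close>]) (use 1 B assms(3) in blast)
    ultimately show ?thesis using 1 B by blast
  next
    case (2 x)
    then show ?thesis using B assms(4) by simp
  qed
next
  case B: (2 y)
  from assms(1) show ?thesis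
  proof (cases rule: dyadic_dcpo_cases)
    case (1 n k)
    then show ?thesis using B assms(4) by simp
  next
    case (2 x)
    then show ?thesis using B assms(3) by simp
  qed
qed

section \<open>Directed suprema and well-foundedness\<close>

lemma partial_order_dyadic_dcpo: "partial_order_on dyadic_dcpo dyadic_le"
  unfolding partial_order_on_def preorder_on_def refl_on_def trans_on_def antisym_on_def
  by (auto simp: dyadic_le_iff)

lemma is_sup_unique:
  assumes "is_sup_in dyadic_dcpo dyadic_le D s" "is_sup_in dyadic_dcpo dyadic_le D t"
  shows "s = t"
proof -
  have "(s, t) \<in> dyadic_le" "(t, s) \<in> dyadic_le"
    using assms by (simp_all add: is_sup_in_def)
  then show ?thesis by (auto simp: dyadic_le_iff)
qed

text \<open>An upper bound lies inside arbitrarily short dyadic intervals that also contain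
  \<open>x\<close>, so each of its points is at distance at most \<open>1 / 2^n\<close> from
  \<open>x\<close> for every \<open>n\<close>. Being nonempty, it equals \<open>{x}\<close>.\<close>

lemma is_sup_singletonI:
  assumes "D \<subseteq> dyadic_dcpo" and mem: "\<And>A. A \<in> D \<Longrightarrow> x \<in> A"
    and fine: "\<And>n. \<exists>A\<in>D. \<exists>k. A \<subseteq> dyadic_ivl n k"
  shows "is_sup_in dyadic_dcpo dyadic_le D {x}"
  unfolding is_sup_in_def
proof (intro conjI ballI impI)
  show "(A, {x}) \<in> dyadic_le" if "A \<in> D" for A
    using that assms by (auto simp: dyadic_le_iff)
next
  fix u assume u: "u \<in> dyadic_dcpo" "\<forall>A\<in>D. (A, u) \<in> dyadic_le"
  have "y = x" if "y \<in> u" for y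
  proof -
    have "y \<le> x + 1 / 2^n \<and> x \<le> y + 1 / 2^n" for n
    proof -
      obtain A k where "A \<in> D" "A \<subseteq> dyadic_ivl n k" using fine by blast
      moreover from this have "x \<in> A" "y \<in> A"
        using mem u that by (auto simp: dyadic_le_iff)
      ultimately show ?thesis using dyadic_ivl_dist by blast
    qed
    then show ?thesis
      by (meson antisym le_if_le_add_inverse_power)
  qed
  then have "u = {x}" using u(1) dyadic_dcpo_subset_singleton by blast
  then show "({x}, u) \<in> dyadic_le" by (simp add: dyadic_le_iff)
qed simp

text \<open>If some member has maximal rank, an element of \<open>D\<close> above it has the same
  rank and hence equals it, so directedness makes it the greatest member. Otherwise the ranks are
  finite and unbounded, and the members close in on a point. The last clause records this shrinking
  for the proof of \<open>nbhd_way_below\<close>.\<close>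

lemma directed_sup:
  assumes D: "directed_in dyadic_dcpo dyadic_le D"
  shows "(\<exists>M\<in>D. is_sup_in dyadic_dcpo dyadic_le D M) \<or>
    (\<exists>x. is_sup_in dyadic_dcpo dyadic_le D {x} \<and> (\<forall>n. \<exists>A\<in>D. \<exists>k. A \<subseteq> dyadic_ivl n k))"
proof (cases "\<exists>M\<in>D. \<forall>A\<in>D. rk A \<le> rk M")
  case True
  then obtain M where M: "M \<in> D" "\<And>A. A \<in> D \<Longrightarrow> rk A \<le> rk M" by blast
  have "(A, M) \<in> dyadic_le" if A: "A \<in> D" for A
  proof -
    obtain Z where Z: "Z \<in> D" "(A, Z) \<in> dyadic_le" "(M, Z) \<in> dyadic_le"
      using D A M(1) unfolding directed_in_def by blast
    then have "M = Z"
      using M(2)[of Z] rk_mono[of M Z] rk_inj[of M Z] by (auto simp: dyadic_le_iff)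
    then show ?thesis using Z by simp
  qed
  then show ?thesis using M(1) D unfolding is_sup_in_def directed_in_def by blast
next
  case False
  have sub: "D \<subseteq> dyadic_dcpo" and ne: "D \<noteq> {}" using D by (auto simp: directed_in_def)
  have large: "\<exists>A\<in>D. enat n \<le> rk A" for n
  proof (induction n)
    case 0
    then show ?case using ne by (auto simp flip: zero_enat_def)
  next
    case (Suc n)
    then obtain A where "A \<in> D" "enat n \<le> rk A" by blast
    moreover from this False obtain B where "B \<in> D" "rk A < rk B" by (meson not_le)
    ultimately show ?case by (metis Suc_ile_eq order.strict_trans1)
  qed
  have fine: "\<exists>A\<in>D. \<exists>k. A \<subseteq> dyadic_ivl n k" for n
  proof -
    obtain A where A: "A \<in> D" "enat n \<le> rk A" using large by blast
    \<comment> \<open>A member of rank \<open>\<infinity>\<close> would have maximal rank, which is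
      excluded in this case.\<close>
    moreover have "rk A \<noteq> \<infinity>" using False A by (metis enat_ord_code(3))
    ultimately obtain m k where "A = dyadic_ivl m k" "n \<le> m"
      using sub by (metis (full_types) dyadic_dcpo_cases enat_ord_simps(1) rk_dyadic_ivl rk_singleton subsetD)
    then show ?thesis using A(1) dyadic_ivl_coarsen by metis
  qed
  have ends: "A = {Inf A..Sup A}" "Inf A \<le> Sup A" if A: "A \<in> D" for A
    using sub A by (auto elim!: dyadic_dcpo_interval)
  \<comment> \<open>The left end of a common refinement belongs to both intervals. So every left end
    is at most every right end, and the supremum of the left ends lies in all members.\<close>
  have below: "Inf A \<le> Sup B" if AB: "A \<in> D" "B \<in> D" for A B
  proof -
    obtain Z where Z: "Z \<in> D" "Z \<subseteq> A" "Z \<subseteq> B"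
      using D AB unfolding directed_in_def dyadic_le_iff by meson
    have "Inf Z \<in> Z" using ends[OF Z(1)] by (metis atLeastAtMost_iff order_refl)
    then have "Inf Z \<in> A" "Inf Z \<in> B" using Z by auto
    then show ?thesis
      using ends(1)[OF AB(1)] ends(1)[OF AB(2)] by (metis atLeastAtMost_iff order_trans)
  qed
  define x where "x = (SUP A\<in>D. Inf A)"
  have "x \<in> A" if A: "A \<in> D" for A
  proof -
    have "bdd_above (Inf ` D)"
      unfolding bdd_above_def using below[OF _ A] by blast
    then have "Inf A \<le> x" unfolding x_def
      by (rule cSUP_upper[OF A])
    moreover have "x \<le> Sup A" unfolding x_def
      by (rule cSUP_least[OF ne]) (rule below[OF _ A])
    ultimately show ?thesis using ends(1)[OF A] by (metis atLeastAtMost_iff)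
  qed
  then show ?thesis using is_sup_singletonI sub fine by blast
qed

lemma dcpo_dyadic_dcpo: "dcpo_on dyadic_dcpo dyadic_le"
  unfolding dcpo_on_def
proof (intro conjI allI impI)
  fix D assume "directed_in dyadic_dcpo dyadic_le D"
  from directed_sup[OF this] show "\<exists>s. is_sup_in dyadic_dcpo dyadic_le D s" by metis
qed (rule partial_order_dyadic_dcpo)

lemma well_founded_dyadic_dcpo: "well_founded_on dyadic_dcpo dyadic_le"
  unfolding well_founded_on_def
proof
  assume "\<exists>f::nat \<Rightarrow> real set. \<forall>i. f i \<in> dyadic_dcpo \<and> (f (Suc i), f i) \<in> dyadic_le \<and> f (Suc i) \<noteq> f i"
  then obtain f :: "nat \<Rightarrow> real set" where
    f: "\<And>i. (f (Suc i), f i) \<in> dyadic_le" "\<And>i. f (Suc i) \<noteq> f i" by blast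
  \<comment> \<open>A strict descent in the order is a strict descent of ranks, and
    \<open>enat\<close> is well-founded.\<close>
  have "rk (f (Suc i)) < rk (f i)" for i
    using f[of i] rk_mono rk_inj by (metis dyadic_le_iff order.not_eq_order_implies_strict)
  then show False
    using wf_no_infinite_down_chainE[OF wf, of "\<lambda>i. rk (f i)"] by blast
qed

section \<open>Dyadic intervals shrinking to a point from either side\<close>

lemma chain_sup:
  assumes dec: "\<And>n. dyadic_ivl (Suc n) (k (Suc n)) \<subseteq> dyadic_ivl n (k n)"
    and mem: "\<And>n. x \<in> dyadic_ivl n (k n)"
  shows "directed_in dyadic_dcpo dyadic_le (range (\<lambda>n. dyadic_ivl n (k n)))"
    and "is_sup_in dyadic_dcpo dyadic_le (range (\<lambda>n. dyadic_ivl n (k n))) {x}"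
proof -
  have sub: "dyadic_ivl m (k m) \<subseteq> dyadic_ivl n (k n)" if "n \<le> m" for n m
    using lift_Suc_antimono_le[of "\<lambda>n. dyadic_ivl n (k n)"] dec that by blast
  show "directed_in dyadic_dcpo dyadic_le (range (\<lambda>n. dyadic_ivl n (k n)))"
    unfolding directed_in_def
  proof (intro conjI ballI)
    fix A B assume "A \<in> range (\<lambda>n. dyadic_ivl n (k n))" "B \<in> range (\<lambda>n. dyadic_ivl n (k n))"
    then obtain m n where "A = dyadic_ivl m (k m)" "B = dyadic_ivl n (k n)" by blast
    then show "\<exists>Z\<in>range (\<lambda>n. dyadic_ivl n (k n)). (A, Z) \<in> dyadic_le \<and> (B, Z) \<in> dyadic_le"
      using sub[of m "max m n"] sub[of n "max m n"] by (auto simp: dyadic_le_iff)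
  qed auto
  show "is_sup_in dyadic_dcpo dyadic_le (range (\<lambda>n. dyadic_ivl n (k n))) {x}"
    by (rule is_sup_singletonI) (use mem in auto)
qed

text \<open>The index is chosen so that \<open>x\<close> lies strictly right of the left end. If
  \<open>x\<close> is a multiple of \<open>1 / 2^n\<close>, it is the right end of
  \<open>lft x n\<close> and the left end of \<open>rgt x n\<close>; otherwise the two intervals
  coincide.\<close>

definition lft :: "real \<Rightarrow> nat \<Rightarrow> real set" where
  "lft x n = dyadic_ivl n (\<lceil>x * 2^n\<rceil> - 1)"

definition rgt :: "real \<Rightarrow> nat \<Rightarrow> real set" where
  "rgt x n = dyadic_ivl n \<lfloor>x * 2^n\<rfloor>"

lemma mem_lft: "x \<in> lft x n" and mem_rgt: "x \<in> rgt x n"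
  unfolding lft_def rgt_def mem_dyadic_ivl_iff by linarith+

lemma lft_in_dyadic_dcpo [simp]: "lft x n \<in> dyadic_dcpo"
  and rgt_in_dyadic_dcpo [simp]: "rgt x n \<in> dyadic_dcpo"
  by (simp_all add: lft_def rgt_def)

lemma lft_Suc: "lft x (Suc n) \<subseteq> lft x n"
proof -
  \<comment> \<open>With \<open>y = x * 2^n\<close>, this says that the index at the next level is
    that of one of the two halves.\<close>
  have "2 * (\<lceil>y\<rceil> - 1) \<le> \<lceil>2 * y\<rceil> - 1 \<and> \<lceil>2 * y\<rceil> - 1 \<le> 2 * (\<lceil>y\<rceil> - 1) + 1" for y :: real
  proof -
    have "\<lceil>2 * y\<rceil> \<le> 2 * \<lceil>y\<rceil>"
      by (simp add: ceiling_le_iff)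
    moreover have "2 * \<lceil>y\<rceil> - 2 < \<lceil>2 * y\<rceil>"
      using ceiling_correct[of y] by (simp add: less_ceiling_iff)
    ultimately show ?thesis by (simp add: algebra_simps)
  qed
  from this[of "x * 2^n"] show ?thesis
    unfolding lft_def by (intro dyadic_ivl_Suc_subset) (simp_all add: mult_ac)
qed

lemma rgt_Suc: "rgt x (Suc n) \<subseteq> rgt x n"
proof -
  have "2 * \<lfloor>y\<rfloor> \<le> \<lfloor>2 * y\<rfloor> \<and> \<lfloor>2 * y\<rfloor> \<le> 2 * \<lfloor>y\<rfloor> + 1" for y :: real
    using floor_correct[of y] floor_correct[of "2 * y"] by linarith
  from this[of "x * 2^n"] show ?thesis
    unfolding rgt_def by (intro dyadic_ivl_Suc_subset) (simp_all add: mult_ac)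
qed

lemma lft_antimono: "m \<le> n \<Longrightarrow> lft x n \<subseteq> lft x m"
  and rgt_antimono: "m \<le> n \<Longrightarrow> rgt x n \<subseteq> rgt x m"
  by (rule lift_Suc_antimono_le[of "lft x", OF lft_Suc], assumption)
    (rule lift_Suc_antimono_le[of "rgt x", OF rgt_Suc])

lemma lft_sup: "directed_in dyadic_dcpo dyadic_le (range (lft x))"
  "is_sup_in dyadic_dcpo dyadic_le (range (lft x)) {x}"
  using chain_sup[of "\<lambda>n. \<lceil>x * 2^n\<rceil> - 1" x] lft_Suc mem_lft by (simp_all add: lft_def)

lemma rgt_sup: "directed_in dyadic_dcpo dyadic_le (range (rgt x))"
  "is_sup_in dyadic_dcpo dyadic_le (range (rgt x)) {x}"
  using chain_sup[of "\<lambda>n. \<lfloor>x * 2^n\<rfloor>" x] rgt_Suc mem_rgt by (simp_all add: rgt_def)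

section \<open>Quasicontinuity\<close>

lemma dyadic_ivl_meets_interval:
  assumes "x \<in> dyadic_ivl n k" "x \<in> {a..b}"
  shows "dyadic_ivl n k \<subseteq> {a..b} \<or> dyadic_ivl n k = lft a n \<or> dyadic_ivl n k = rgt b n"
proof -
  have ab: "a * 2^n \<le> x * 2^n" "x * 2^n \<le> b * 2^n" using assms(2) by simp_all
  have x: "of_int k \<le> x * 2^n" "x * 2^n \<le> of_int k + 1"
    using assms(1) by (simp_all add: mem_dyadic_ivl_iff)
  \<comment> \<open>The interval sticks out of \<open>{a..b}\<close> on the left, on the right, or
    not at all. Since \<open>x\<close> lies in both, sticking out on the left puts
    \<open>a * 2^n\<close> in the half-open range from \<open>k\<close> (excluded) to
    \<open>k + 1\<close>, which fixes its ceiling; on the right the floor of \<open>b * 2^n\<close>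
    is fixed likewise.\<close>
  consider "of_int k < a * 2^n" | "b * 2^n < of_int k + 1" | "a * 2^n \<le> of_int k" "of_int k + 1 \<le> b * 2^n"
    by linarith
  then show ?thesis
  proof cases
    case 1
    then have "\<lceil>a * 2^n\<rceil> = k + 1" using ab x by (intro ceiling_unique) linarith+
    then show ?thesis by (simp add: lft_def)
  next
    case 2
    then have "\<lfloor>b * 2^n\<rfloor> = k" using ab x by (intro floor_unique) linarith+
    then show ?thesis by (simp add: rgt_def)
  next
    case 3
    then have "dyadic_ivl n k \<subseteq> {a..b}" by (simp add: dyadic_ivl_def field_simps)
    then show ?thesis by blast
  qed
qed

definition nbhd :: "real \<Rightarrow> real \<Rightarrow> nat \<Rightarrow> real set set" where
  "nbhd a b n = {{a..b}, lft a n, rgt b n}"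

lemma nbhd_way_below:
  assumes "{a..b} \<in> dyadic_dcpo"
  shows "way_below dyadic_dcpo dyadic_le (nbhd a b n) {{a..b}}"
  unfolding way_below_def
proof (intro allI impI)
  fix D s
  assume D: "directed_in dyadic_dcpo dyadic_le D"
    and s: "is_sup_in dyadic_dcpo dyadic_le D s" "s \<in> upset dyadic_dcpo dyadic_le {{a..b}}"
  have sub: "D \<subseteq> dyadic_dcpo" using D by (simp add: directed_in_def)
  have sab: "s \<subseteq> {a..b}" using s(2) by (auto simp: upset_def dyadic_le_iff)
  from directed_sup[OF D] show "D \<inter> upset dyadic_dcpo dyadic_le (nbhd a b n) \<noteq> {}"
  proof (elim disjE bexE exE conjE)
    fix M assume "M \<in> D" "is_sup_in dyadic_dcpo dyadic_le D M"
    then have "s \<in> D" using s(1) is_sup_unique by blast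
    then show ?thesis using s(2) by (auto simp: upset_def nbhd_def)
  next
    fix x assume x: "is_sup_in dyadic_dcpo dyadic_le D {x}" "\<forall>n. \<exists>A\<in>D. \<exists>k. A \<subseteq> dyadic_ivl n k"
    \<comment> \<open>The shrinking of \<open>D\<close> is used at the level \<open>n\<close> of
      \<open>nbhd a b n\<close>. The interval found contains the point \<open>x\<close> of
      \<open>{a..b}\<close>, so the trichotomy applies to it.\<close>
    then obtain A k where A: "A \<in> D" "A \<subseteq> dyadic_ivl n k" by blast
    have "s = {x}" using x s is_sup_unique by blast
    then have "x \<in> A" using s(1) A(1) by (auto simp: is_sup_in_def dyadic_le_iff)
    then have "dyadic_ivl n k \<subseteq> {a..b} \<or> dyadic_ivl n k = lft a n \<or> dyadic_ivl n k = rgt b n"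
      using dyadic_ivl_meets_interval A(2) sab \<open>s = {x}\<close> by blast
    then have "A \<in> upset dyadic_dcpo dyadic_le (nbhd a b n)"
      using A assms sub by (auto simp: upset_def nbhd_def dyadic_le_iff)
    then show ?thesis using A(1) by blast
  qed
qed

lemma upset_dyadic_subset:
  assumes "A \<in> upset dyadic_dcpo dyadic_le F" "B \<in> dyadic_dcpo" "B \<subseteq> A"
  shows "B \<in> upset dyadic_dcpo dyadic_le F"
proof -
  obtain C where "C \<in> F" "C \<in> dyadic_dcpo" "A \<subseteq> C"
    using assms(1) by (auto simp: upset_def dyadic_le_iff)
  then show ?thesis using assms(2,3) by (auto simp: upset_def dyadic_le_iff)
qed

text \<open>The relation \<open>way_below\<close> is tested on three directed sets:
  \<open>{a..b}\<close> alone, the intervals \<open>lft a m\<close> with supremum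
  \<open>{a}\<close>, and the intervals \<open>rgt b m\<close> with supremum \<open>{b}\<close>.
  Each meets the upset of \<open>F\<close>, and from the larger of the two levels on, all of
  \<open>nbhd a b n\<close> lies in it.\<close>

lemma upset_nbhd_cofinal:
  assumes A: "{a..b} \<in> dyadic_dcpo" "a \<le> b" and F: "way_below dyadic_dcpo dyadic_le F {{a..b}}"
  shows "\<exists>m. \<forall>n\<ge>m. upset dyadic_dcpo dyadic_le (nbhd a b n) \<subseteq> upset dyadic_dcpo dyadic_le F"
proof -
  have "directed_in dyadic_dcpo dyadic_le {{a..b}}" "is_sup_in dyadic_dcpo dyadic_le {{a..b}} {a..b}"
    using A by (auto simp: directed_in_def is_sup_in_def dyadic_le_iff)
  then have "{a..b} \<in> upset dyadic_dcpo dyadic_le F"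
    using F A unfolding way_below_def upset_def by (auto simp: dyadic_le_iff)
  moreover have "{a} \<in> upset dyadic_dcpo dyadic_le {{a..b}}"
    "{b} \<in> upset dyadic_dcpo dyadic_le {{a..b}}"
    using A by (auto simp: upset_def dyadic_le_iff)
  then have "\<exists>m. lft a m \<in> upset dyadic_dcpo dyadic_le F"
    "\<exists>m. rgt b m \<in> upset dyadic_dcpo dyadic_le F"
    using F lft_sup[of a] rgt_sup[of b] unfolding way_below_def by blast+
  ultimately obtain i j where ij: "{a..b} \<in> upset dyadic_dcpo dyadic_le F"
    "lft a i \<in> upset dyadic_dcpo dyadic_le F" "rgt b j \<in> upset dyadic_dcpo dyadic_le F" by blast
  have "upset dyadic_dcpo dyadic_le (nbhd a b n) \<subseteq> upset dyadic_dcpo dyadic_le F"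
    if n: "n \<ge> max i j" for n
  proof
    fix B assume "B \<in> upset dyadic_dcpo dyadic_le (nbhd a b n)"
    then have "B \<in> dyadic_dcpo" "B \<subseteq> {a..b} \<or> B \<subseteq> lft a i \<or> B \<subseteq> rgt b j"
      using lft_antimono[of i n a] rgt_antimono[of j n b] n
      by (auto simp: upset_def nbhd_def dyadic_le_iff)
    then show "B \<in> upset dyadic_dcpo dyadic_le F"
      using ij upset_dyadic_subset by blast
  qed
  then show ?thesis by blast
qed

text \<open>No member of \<open>nbhd a b n\<close> reaches further than \<open>1 / 2^n\<close>
  beyond \<open>{a..b}\<close>. Which member contains \<open>B\<close> may change with
  \<open>n\<close>, hence the estimate for single points.\<close>

lemma Inter_upset_nbhd:
  assumes "a \<le> b" "\<And>n. B \<in> upset dyadic_dcpo dyadic_le (nbhd a b n)"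
  shows "B \<subseteq> {a..b}"
proof
  fix y assume y: "y \<in> B"
  have "y \<le> b + 1 / 2^n \<and> a \<le> y + 1 / 2^n" for n
  proof -
    have "y \<in> {a..b} \<or> y \<in> lft a n \<or> y \<in> rgt b n"
      using assms(2)[of n] y by (auto simp: upset_def nbhd_def dyadic_le_iff)
    then show ?thesis
    proof (elim disjE)
      assume "y \<in> {a..b}"
      then show ?thesis by (auto intro: add_increasing2)
    next
      assume "y \<in> lft a n"
      then have "y \<le> a + 1 / 2^n" "a \<le> y + 1 / 2^n"
        using mem_lft[of a n] dyadic_ivl_dist unfolding lft_def by blast+
      then show ?thesis using assms(1) by linarith
    next
      assume "y \<in> rgt b n"
      then have "y \<le> b + 1 / 2^n" "b \<le> y + 1 / 2^n"
        using mem_rgt[of b n] dyadic_ivl_dist unfolding rgt_def by blast+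
      then show ?thesis using assms(1) by linarith
    qed
  qed
  then show "y \<in> {a..b}"
    using le_if_le_add_inverse_power by auto
qed

lemma quasicontinuous_dyadic_dcpo: "quasicontinuous_on dyadic_dcpo dyadic_le"
  unfolding quasicontinuous_on_def Let_def
proof (intro ballI)
  fix A assume A: "A \<in> dyadic_dcpo"
  then obtain a b where ab: "a \<le> b" "A = {a..b}" by (rule dyadic_dcpo_interval)
  define \<F> where "\<F> = {upset dyadic_dcpo dyadic_le F |F.
    F \<subseteq> dyadic_dcpo \<and> finite F \<and> way_below dyadic_dcpo dyadic_le F {A}}"
  \<comment> \<open>The facts \<open>nb\<close> and \<open>cofinal\<close> reduce the family to the
    sequence of upsets of \<open>nbhd a b n\<close>; filteredness and the intersection are then read
    off from this sequence.\<close>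
  have nb: "upset dyadic_dcpo dyadic_le (nbhd a b n) \<in> \<F>" for n
    using nbhd_way_below[of a b n] A ab by (fastforce simp: nbhd_def \<F>_def)
  have cofinal: "\<exists>m. \<forall>n\<ge>m. upset dyadic_dcpo dyadic_le (nbhd a b n) \<subseteq> U" if U: "U \<in> \<F>" for U
  proof -
    obtain F where "U = upset dyadic_dcpo dyadic_le F" "way_below dyadic_dcpo dyadic_le F {A}"
      using U unfolding \<F>_def by blast
    then show ?thesis using upset_nbhd_cofinal[of a b F] A ab by simp
  qed
  have "filtered_family \<F>"
    unfolding filtered_family_def
  proof (intro conjI ballI)
    show "\<F> \<noteq> {}" using nb by blast
    fix U V assume "U \<in> \<F>" "V \<in> \<F>"
    with cofinal[of U] cofinal[of V]
    obtain i j where "\<forall>n\<ge>i. upset dyadic_dcpo dyadic_le (nbhd a b n) \<subseteq> U"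
      "\<forall>n\<ge>j. upset dyadic_dcpo dyadic_le (nbhd a b n) \<subseteq> V" by blast
    then have "upset dyadic_dcpo dyadic_le (nbhd a b (max i j)) \<subseteq> U \<inter> V" by simp
    then show "\<exists>W\<in>\<F>. W \<subseteq> U \<inter> V" using nb by blast
  qed
  moreover have "\<Inter> \<F> = upset dyadic_dcpo dyadic_le {A}"
  proof
    show "\<Inter> \<F> \<subseteq> upset dyadic_dcpo dyadic_le {A}"
    proof
      fix B assume "B \<in> \<Inter> \<F>"
      then have B: "B \<in> upset dyadic_dcpo dyadic_le (nbhd a b n)" for n using nb by blast
      then have "B \<subseteq> A" using Inter_upset_nbhd ab by blast
      then show "B \<in> upset dyadic_dcpo dyadic_le {A}"
        using B A by (auto simp: upset_def dyadic_le_iff)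
    qed
    show "upset dyadic_dcpo dyadic_le {A} \<subseteq> \<Inter> \<F>"
    proof (intro Inter_greatest)
      fix U assume "U \<in> \<F>"
      then obtain n where "upset dyadic_dcpo dyadic_le (nbhd a b n) \<subseteq> U"
        using cofinal[of U] by blast
      then show "upset dyadic_dcpo dyadic_le {A} \<subseteq> U"
        using ab by (auto simp: upset_def nbhd_def)
    qed
  qed
  ultimately show "filtered_family {upset dyadic_dcpo dyadic_le F |F.
      F \<subseteq> dyadic_dcpo \<and> finite F \<and> way_below dyadic_dcpo dyadic_le F {A}} \<and>
    \<Inter> {upset dyadic_dcpo dyadic_le F |F.
      F \<subseteq> dyadic_dcpo \<and> finite F \<and> way_below dyadic_dcpo dyadic_le F {A}} =
    upset dyadic_dcpo dyadic_le {A}"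
    unfolding \<F>_def ..
qed

section \<open>Failure of algebraicity and quasialgebraicity\<close>

lemma way_below_self_empty:
  assumes F: "F \<subseteq> dyadic_dcpo" "finite F" and wb: "way_below dyadic_dcpo dyadic_le F F"
  shows "F = {}"
proof (rule ccontr)
  assume "F \<noteq> {}"
  define b where "b = Max (Sup ` F)"
  have "b \<in> Sup ` F" using F \<open>F \<noteq> {}\<close> by (simp add: b_def)
  then obtain A where A: "A \<in> F" "b = Sup A" by blast
  then have "b \<in> A" using F(1) by (auto elim!: dyadic_dcpo_interval)
  then have "{b} \<in> upset dyadic_dcpo dyadic_le F"
    using A(1) F(1) by (auto simp: upset_def dyadic_le_iff)
  then obtain n where "rgt b n \<in> upset dyadic_dcpo dyadic_le F"
    using wb rgt_sup[of b] unfolding way_below_def by blast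
  then obtain B where B: "B \<in> F" "rgt b n \<subseteq> B" by (auto simp: upset_def dyadic_le_iff)
  \<comment> \<open>The right end of \<open>rgt b n\<close> lies strictly beyond \<open>b\<close>,
    because the floor plus one exceeds \<open>b * 2^n\<close>. Yet it belongs to \<open>B\<close>,
    whose right end is at most the maximum \<open>b\<close>.\<close>
  let ?y = "(of_int \<lfloor>b * 2^n\<rfloor> + 1) / 2^n"
  have "?y \<in> B" using B(2) by (auto simp: rgt_def mem_dyadic_ivl_iff)
  then have "?y \<le> Sup B" using B(1) F(1) by (auto elim!: dyadic_dcpo_interval)
  also have "\<dots> \<le> b" using B(1) F(2) by (simp add: b_def)
  finally have "of_int \<lfloor>b * 2^n\<rfloor> + 1 \<le> b * 2^n" by (simp add: field_simps)
  then show False by linarith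
qed

lemma not_quasialgebraic_dyadic_dcpo: "\<not> quasialgebraic_on dyadic_dcpo dyadic_le"
proof
  assume "quasialgebraic_on dyadic_dcpo dyadic_le"
  \<comment> \<open>A filtered family is nonempty, so a suitable \<open>F\<close> exists at the
    sample point \<open>{0}\<close>; it is nonempty because its upset contains
    \<open>{0}\<close>.\<close>
  then obtain F where "F \<subseteq> dyadic_dcpo" "finite F"
    "{0} \<in> upset dyadic_dcpo dyadic_le F" "way_below dyadic_dcpo dyadic_le F F"
    unfolding quasialgebraic_on_def Let_def filtered_family_def
    using singleton_in_dyadic_dcpo[of 0] by fastforce
  then show False using way_below_self_empty[of F] by (auto simp: upset_def)
qed

lemma not_algebraic_dyadic_dcpo: "\<not> algebraic_on dyadic_dcpo dyadic_le"
proof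
  assume "algebraic_on dyadic_dcpo dyadic_le"
  \<comment> \<open>The compact elements below \<open>{0}\<close> form a directed, hence nonempty,
    set.\<close>
  then obtain c where "compact_in dyadic_dcpo dyadic_le c"
    unfolding algebraic_on_def Let_def directed_in_def
    using singleton_in_dyadic_dcpo[of 0] by fastforce
  then show False using way_below_self_empty[of "{c}"] by (auto simp: compact_in_def)
qed

section \<open>Maximal elements and chains\<close>

lemma maximal_dyadic_dcpo: "maximal_elements dyadic_dcpo dyadic_le = range (\<lambda>x. {x})"
proof
  show "maximal_elements dyadic_dcpo dyadic_le \<subseteq> range (\<lambda>x. {x})"
  proof
    fix A assume A: "A \<in> maximal_elements dyadic_dcpo dyadic_le"
    then obtain x where "x \<in> A" using dyadic_dcpo_nonempty by (auto simp: maximal_elements_def)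
    then have "(A, {x}) \<in> dyadic_le" using A by (simp add: maximal_elements_def dyadic_le_iff)
    then have "{x} = A" using A by (simp add: maximal_elements_def)
    then show "A \<in> range (\<lambda>x. {x})" by blast
  qed
  show "range (\<lambda>x. {x}) \<subseteq> maximal_elements dyadic_dcpo dyadic_le"
    using dyadic_dcpo_subset_singleton by (auto simp: maximal_elements_def dyadic_le_iff)
qed

text \<open>On pairwise comparable elements the rank both preserves and reflects the order: if
  \<open>B\<close> has at least the rank of \<open>A\<close> but contains \<open>A\<close>, the
  ranks agree and \<open>rk_inj\<close> gives equality.\<close>

lemma chain_dyadic_dcpo:
  assumes C: "chain_in dyadic_dcpo dyadic_le C"
  shows "order_isomorphic C dyadic_le (rk ` C) omega_plus_one_le"
proof -
  have cmp: "A \<in> dyadic_dcpo \<and> B \<in> dyadic_dcpo \<and> (A \<subseteq> B \<or> B \<subseteq> A)" if "A \<in> C" "B \<in> C" for A B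
    using C that unfolding chain_in_def dyadic_le_iff by blast
  have "inj_on rk C"
    by (rule inj_onI) (metis cmp rk_inj)
  moreover have "(A, B) \<in> dyadic_le \<longleftrightarrow> rk A \<le> rk B" if AB: "A \<in> C" "B \<in> C" for A B
    using cmp[OF AB] rk_mono[of A B] rk_mono[of B A] rk_inj[of B A]
    by (auto simp: dyadic_le_iff)
  ultimately show ?thesis
    unfolding order_isomorphic_def omega_plus_one_le_def
    by (intro exI[of _ rk]) (simp add: inj_on_imp_bij_betw)
qed

section \<open>Excluding the unit interval as sub-dcpo and as retract\<close>

lemma no_monotone_injection_unit_interval:
  assumes "well_founded_on P r"
    and g: "\<And>x. x \<in> unit_interval \<Longrightarrow> g x \<in> P" "inj_on g unit_interval"
      "\<And>x y. (x, y) \<in> unit_interval_le \<Longrightarrow> (g x, g y) \<in> r"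
  shows False
proof -
  \<comment> \<open>The powers of \<open>1/2\<close> descend strictly in the unit interval, and a
    monotone injection carries them to an infinite strict descent in \<open>P\<close>. The inverse
    of an isomorphism and the section of a retraction are both such injections.\<close>
  define u :: "nat \<Rightarrow> real" where "u i = (1/2)^i" for i
  have "u i \<in> unit_interval" "u (Suc i) \<noteq> u i" "u (Suc i) \<le> u i" for i
    by (auto simp: u_def unit_interval_def power_le_one)
  then have u: "u i \<in> unit_interval" "u (Suc i) \<noteq> u i" "(u (Suc i), u i) \<in> unit_interval_le" for i
    by (auto simp: unit_interval_le_def)
  have "\<forall>i. g (u i) \<in> P \<and> (g (u (Suc i)), g (u i)) \<in> r \<and> g (u (Suc i)) \<noteq> g (u i)"
    using g u by (metis inj_onD)
  then show False using assms(1) unfolding well_founded_on_def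
    by (auto dest: spec[of _ "\<lambda>i. g (u i)"])
qed

lemma no_unit_interval_sub_dcpo:
  assumes wf: "well_founded_on P r" and Q: "sub_dcpo P r Q"
  shows "\<not> order_isomorphic Q r unit_interval unit_interval_le"
proof
  assume "order_isomorphic Q r unit_interval unit_interval_le"
  then obtain f where f: "bij_betw f Q unit_interval"
    "\<And>x y. x \<in> Q \<Longrightarrow> y \<in> Q \<Longrightarrow> (x, y) \<in> r \<longleftrightarrow> (f x, f y) \<in> unit_interval_le"
    unfolding order_isomorphic_def by blast
  let ?g = "inv_into Q f"
  have g: "bij_betw ?g unit_interval Q" using f(1) by (rule bij_betw_inv_into)
  have fg: "f (?g x) = x" if "x \<in> unit_interval" for x
    using f(1) that by (rule bij_betw_inv_into_right)
  show False
  proof (rule no_monotone_injection_unit_interval[OF wf])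
    show "?g x \<in> P" if "x \<in> unit_interval" for x
      using g that Q by (auto simp: bij_betw_def sub_dcpo_def)
    show "inj_on ?g unit_interval" using g by (simp add: bij_betw_def)
    show "(?g x, ?g y) \<in> r" if "(x, y) \<in> unit_interval_le" for x y
    proof -
      have "x \<in> unit_interval" "y \<in> unit_interval" using that by (auto simp: unit_interval_le_def)
      then show ?thesis using f(2)[of "?g x" "?g y"] that g fg by (simp add: bij_betw_apply)
    qed
  qed
qed

lemma no_unit_interval_retract:
  assumes wf: "well_founded_on P r"
  shows "\<not> scott_retract_of unit_interval unit_interval_le P r"
proof
  assume "scott_retract_of unit_interval unit_interval_le P r"
  then obtain \<rho> e where e: "scott_continuous unit_interval unit_interval_le P r e"
    "\<And>x. x \<in> unit_interval \<Longrightarrow> \<rho> (e x) = x"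
    unfolding scott_retract_of_def by blast
  show False
  proof (rule no_monotone_injection_unit_interval[OF wf])
    show "e x \<in> P" if "x \<in> unit_interval" for x
      using e(1) that by (auto simp: scott_continuous_def)
    show "inj_on e unit_interval" using e(2) by (rule inj_on_inverseI)
    show "(e x, e y) \<in> r" if "(x, y) \<in> unit_interval_le" for x y
      using e(1) that by (auto simp: scott_continuous_def unit_interval_le_def)
  qed
qed

theorem theorem1p1:
  shows "\<exists>(P :: real set set) (r :: real set rel).
    dcpo_on P r \<and> well_founded_on P r \<and> quasicontinuous_on P r \<and>
    \<not> algebraic_on P r \<and> \<not> quasialgebraic_on P r \<and>
    (antichain_in P r (maximal_elements P r) \<and>
      maximal_elements P r \<approx> Pow (UNIV :: nat set)) \<and>
    (\<forall>C. chain_in P r C \<longrightarrow>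
      (\<exists>S. order_isomorphic C r S omega_plus_one_le)) \<and>
    \<not> (\<exists>Q. sub_dcpo P r Q \<and> order_isomorphic Q r unit_interval unit_interval_le) \<and>
    \<not> scott_retract_of unit_interval unit_interval_le P r"
proof (intro exI[of _ dyadic_dcpo] exI[of _ dyadic_le] conjI)
  show "antichain_in dyadic_dcpo dyadic_le (maximal_elements dyadic_dcpo dyadic_le)"
    by (auto simp: antichain_in_def maximal_elements_def)
  have "range (\<lambda>x::real. {x}) \<approx> (UNIV :: real set)"
    by (intro inj_on_image_eqpoll_self) (simp add: inj_on_def)
  then show "maximal_elements dyadic_dcpo dyadic_le \<approx> Pow (UNIV :: nat set)"
    unfolding maximal_dyadic_dcpo Pow_UNIV
    using eqpoll_trans eqpoll_sym nat_sets_eqpoll_reals by blast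
  show "\<forall>C. chain_in dyadic_dcpo dyadic_le C \<longrightarrow>
      (\<exists>S. order_isomorphic C dyadic_le S omega_plus_one_le)"
    by (intro allI impI exI) (rule chain_dyadic_dcpo)
  show "\<not> (\<exists>Q. sub_dcpo dyadic_dcpo dyadic_le Q \<and>
      order_isomorphic Q dyadic_le unit_interval unit_interval_le)"
    by (auto dest: no_unit_interval_sub_dcpo[OF well_founded_dyadic_dcpo])
  show "\<not> scott_retract_of unit_interval unit_interval_le dyadic_dcpo dyadic_le"
    by (rule no_unit_interval_retract[OF well_founded_dyadic_dcpo])
qed (rule dcpo_dyadic_dcpo well_founded_dyadic_dcpo quasicontinuous_dyadic_dcpo
    not_algebraic_dyadic_dcpo not_quasialgebraic_dyadic_dcpo)+

end
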